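(* Let $\mathcal{H}$ be a complex Hilbert space and let $T:\mathbb{Z}_2\to\mathcal{B}(\mathcal{H})$ be a function such that $T(0)$ and $T(1)$ are self-adjoint operators. Then the following are equivalent. (1) $T$ is a positive definite function. (2) The block matrix $\begin{bmatrix} T(0) & T(1)\\ T(1) & T(0)\end{bmatrix}$ is a positive operator on $\mathcal{H}^2=\mathcal{H}\oplus\mathcal{H}$. (3) $T(0)$ is positive and there is a contraction $\Gamma:\overline{T(0)\mathcal{H}}\to\overline{T(0)\mathcal{H}}$ such that $T(1)=T(0)^{1/2}\,\Gamma\,T(0)^{1/2}$. (4) $T(0)$ is positive and $\pm T(1)\le T(0)$.
   Context: $\mathcal{B}(\mathcal{H})$ is the algebra of bounded linear operators on $\mathcal{H}$; "positive" for an operator $A$ means $\langle Ax,x\rangle\ge 0$ for all $x$; a contraction is an operator of norm at most one; $A^{1/2}$ is the positive square root of a positive operator. For a group $G$, a map $T:G\to\mathcal{B}(\mathcal{H})$ is positive definite if $T(s^{-1})=T(s)^*$ for every $s\in G$ and $\sum_{s\in G}\sum_{t\in G}\langle T(t^{-1}s)h(s),h(t)\rangle\ge 0$ for every finitely supported function $h:G\to\mathcal{H}$. $\mathbb{Z}_2=\{0,1\}$ is the (additive) cyclic group of order 2. *)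

theory Defs
  imports "HOL-Analysis.Analysis" "HOL-Library.Z2"
begin

section \<open>Complex Hilbert spaces\<close>

text \<open>
  A complex inner product space is a real one whose scalar multiplication extends to \<open>\<complex>\<close>
  and whose real inner product is the real part of a sesquilinear form. The form is linear in
  its first argument. The norm is \<open>norm x = sqrt (inner x x)\<close> by \<^class>\<open>real_inner\<close>,
  and positive definiteness of the form is also inherited from there, as \<open>cinner x x\<close> is real.
\<close>

class complex_inner = real_inner +
  fixes scaleC :: "complex \<Rightarrow> 'a \<Rightarrow> 'a" (infixr \<open>*\<^sub>C\<close> 75)
    and cinner :: "'a \<Rightarrow> 'a \<Rightarrow> complex"
  assumes scaleC_add_right: "c *\<^sub>C (x + y) = c *\<^sub>C x + c *\<^sub>C y"
    and scaleC_add_left: "(c + d) *\<^sub>C x = c *\<^sub>C x + d *\<^sub>C x"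
    and scaleC_scaleC: "c *\<^sub>C d *\<^sub>C x = (c * d) *\<^sub>C x"
    and scaleC_of_real: "complex_of_real r *\<^sub>C x = r *\<^sub>R x"
    and cinner_commute: "cinner x y = cnj (cinner y x)"
    and cinner_add_left: "cinner (x + y) z = cinner x z + cinner y z"
    and cinner_scaleC_left: "cinner (c *\<^sub>C x) y = c * cinner x y"
    and Re_cinner: "Re (cinner x y) = inner x y"

lemma cinner_self: "cinner x x = complex_of_real ((norm x)\<^sup>2)"
  for x :: "'a::complex_inner"
proof -
  have "cinner x x = cnj (cinner x x)"
    by (rule cinner_commute)
  then have "Im (cinner x x) = 0"
    by (simp add: complex_eq_iff)
  then show ?thesis
    by (simp add: complex_eq_iff Re_cinner power2_norm_eq_inner)
qed

class chilbert_space = complex_inner + complete_space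

instantiation complex :: chilbert_space
begin

definition scaleC_complex :: "complex \<Rightarrow> complex \<Rightarrow> complex"
  where "scaleC_complex c x = c * x"

definition cinner_complex :: "complex \<Rightarrow> complex \<Rightarrow> complex"
  where "cinner_complex x y = x * cnj y"

instance
  by standard (simp_all add: scaleC_complex_def cinner_complex_def algebra_simps
      scaleR_conv_of_real inner_complex_def)

end

text \<open>The Hilbert space direct sum.\<close>

instantiation prod :: (complex_inner, complex_inner) complex_inner
begin

definition scaleC_prod :: "complex \<Rightarrow> 'a \<times> 'b \<Rightarrow> 'a \<times> 'b"
  where "scaleC_prod c x = (c *\<^sub>C fst x, c *\<^sub>C snd x)"

definition cinner_prod :: "'a \<times> 'b \<Rightarrow> 'a \<times> 'b \<Rightarrow> complex"
  where "cinner_prod x y = cinner (fst x) (fst y) + cinner (snd x) (snd y)"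

instance
proof
  fix x y :: "'a \<times> 'b"
  show "cinner x y = cnj (cinner y x)"
    unfolding cinner_prod_def by (metis cinner_commute complex_cnj_add)
qed (simp_all add: scaleC_prod_def cinner_prod_def scaleC_add_right scaleC_add_left
      scaleC_scaleC scaleC_of_real cinner_add_left cinner_scaleC_left Re_cinner
      inner_prod_def scaleR_prod_def algebra_simps)

end

instance prod :: (chilbert_space, chilbert_space) chilbert_space ..


section \<open>Bounded operators\<close>

text \<open>The algebra \<open>\<B>(H)\<close> is the set of \<open>A :: 'a \<Rightarrow> 'a\<close> with \<open>bounded_clinear A\<close>.\<close>

definition bounded_clinear :: "('a::complex_inner \<Rightarrow> 'b::complex_inner) \<Rightarrow> bool"
  where "bounded_clinear A \<longleftrightarrow> bounded_linear A \<and> (\<forall>c x. A (c *\<^sub>C x) = c *\<^sub>C A x)"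

text \<open>
  \<open>is_adjoint A B\<close> says \<open>B = A\<^sup>*\<close>: the adjoint is characterised by this identity, and
  \<open>is_adjoint_unique\<close> shows that the identity determines it.
\<close>

definition is_adjoint :: "('a::complex_inner \<Rightarrow> 'b::complex_inner) \<Rightarrow> ('b \<Rightarrow> 'a) \<Rightarrow> bool"
  where "is_adjoint A B \<longleftrightarrow> (\<forall>x y. cinner (A x) y = cinner x (B y))"

lemma is_adjoint_unique:
  assumes "is_adjoint A B" "is_adjoint A C"
  shows "B = C"
proof
  fix y
  have "cinner x (B y) = cinner x (C y)" for x
    using assms by (metis is_adjoint_def)
  then have "inner x (B y) = inner x (C y)" for x
    by (metis Re_cinner)
  then show "B y = C y"
    using vector_eq_ldot by blast
qed

definition selfadjoint :: "('a::complex_inner \<Rightarrow> 'a) \<Rightarrow> bool"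
  where "selfadjoint A \<longleftrightarrow> is_adjoint A A"

definition positive_op :: "('a::complex_inner \<Rightarrow> 'a) \<Rightarrow> bool"
  where "positive_op A \<longleftrightarrow> bounded_clinear A \<and> (\<forall>x. cinner (A x) x \<in> \<real>\<^sub>\<ge>\<^sub>0)"

definition op_le :: "('a::complex_inner \<Rightarrow> 'a) \<Rightarrow> ('a \<Rightarrow> 'a) \<Rightarrow> bool"
  where "op_le A B \<longleftrightarrow> positive_op (\<lambda>x. B x - A x)"

definition op_sqrt :: "('a::chilbert_space \<Rightarrow> 'a) \<Rightarrow> 'a \<Rightarrow> 'a"
  where "op_sqrt A = (THE R. positive_op R \<and> R \<circ> R = A)"

definition block_op ::
    "('a::complex_inner \<Rightarrow> 'a) \<Rightarrow> ('a \<Rightarrow> 'a) \<Rightarrow> ('a \<Rightarrow> 'a) \<Rightarrow> ('a \<Rightarrow> 'a) \<Rightarrow> 'a \<times> 'a \<Rightarrow> 'a \<times> 'a"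
  where "block_op A B C D = (\<lambda>(x, y). (A x + B y, C x + D y))"

text \<open>
  An operator on a subspace \<open>M\<close> is represented by a total function that is only constrained
  on \<open>M\<close>. The operator norm \<open>onorm_on M\<close> is \<open>onorm\<close> relativised to \<open>M\<close>; the quotient at
  \<open>x = 0\<close> is \<open>0\<close>.
\<close>

definition bounded_clinear_on :: "'a::complex_inner set \<Rightarrow> ('a \<Rightarrow> 'a) \<Rightarrow> bool"
  where "bounded_clinear_on M A \<longleftrightarrow>
    (\<forall>x\<in>M. A x \<in> M) \<and>
    (\<forall>x\<in>M. \<forall>y\<in>M. A (x + y) = A x + A y) \<and>
    (\<forall>c. \<forall>x\<in>M. A (c *\<^sub>C x) = c *\<^sub>C A x) \<and>
    (\<exists>K. \<forall>x\<in>M. norm (A x) \<le> norm x * K)"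

definition onorm_on :: "'a::complex_inner set \<Rightarrow> ('a \<Rightarrow> 'a) \<Rightarrow> real"
  where "onorm_on M A = (SUP x\<in>M. norm (A x) / norm x)"

definition contraction_on :: "'a::complex_inner set \<Rightarrow> ('a \<Rightarrow> 'a) \<Rightarrow> bool"
  where "contraction_on M A \<longleftrightarrow> bounded_clinear_on M A \<and> onorm_on M A \<le> 1"


section \<open>Positive definite functions\<close>

text \<open>
  The group is written additively, so \<open>t\<^sup>-\<^sup>1 s\<close> becomes \<open>- t + s\<close>. Both sums run over the
  support of \<open>h\<close>, outside of which the terms vanish.
\<close>

definition positive_definite :: "('g::group_add \<Rightarrow> 'a::complex_inner \<Rightarrow> 'a) \<Rightarrow> bool"
  where "positive_definite T \<longleftrightarrow>
    (\<forall>s. is_adjoint (T s) (T (- s))) \<and>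
    (\<forall>h. finite {s. h s \<noteq> 0} \<longrightarrow>
      (\<Sum>s | h s \<noteq> 0. \<Sum>t | h t \<noteq> 0. cinner (T (- t + s) (h s)) (h t)) \<in> \<real>\<^sub>\<ge>\<^sub>0)"

end

theory Submission
  imports Defs
begin

text \<open>
  Everything is compared with the condition \<open>\<bar>\<langle>T(1)x, x\<rangle>\<bar> \<le> \<langle>T(0)x, x\<rangle>\<close>, which is (4). The quadratic
  form of the block matrix at \<open>(h(0), h(1))\<close> is the double sum of positive definiteness, and up to a
  change of variables it is the sum of the forms of \<open>T(0) + T(1)\<close> at \<open>x + y\<close> and of \<open>T(0) - T(1)\<close> at
  \<open>x - y\<close>. By polarisation and scaling, (4) gives \<open>\<bar>\<langle>T(1)x, y\<rangle>\<bar> \<le> \<parallel>Rx\<parallel> \<parallel>Ry\<parallel>\<close> with \<open>R = T(0)\<^sup>1\<^sup>/\<^sup>2\<close>, so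
  that \<open>(Rx, Ry) \<mapsto> \<langle>T(1)x, y\<rangle>\<close> is a well-defined form of norm at most one; it is represented by \<open>\<Gamma>\<close>.
\<close>

text \<open>Makes the square root iteration, which runs over a Banach space, available on a Hilbert
  space.\<close>

instance chilbert_space \<subseteq> banach ..

section \<open>Complex inner products and positive operators\<close>

lemma cinner_add_right: "cinner x (y + z) = cinner x y + cinner x z"
  by (metis cinner_add_left cinner_commute complex_cnj_add)

lemma cinner_scaleC_right: "cinner x (c *\<^sub>C y) = cnj c * cinner x y"
  by (metis cinner_commute cinner_scaleC_left complex_cnj_mult)

lemma cinner_zero_left [simp]: "cinner 0 x = 0"
  using cinner_add_left[of 0 0 x] by simp

lemma cinner_zero_right [simp]: "cinner x 0 = 0"
  using cinner_add_right[of x 0 0] by simp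

text \<open>Imaginary parts are real parts at \<open>\<i> *\<^sub>C y\<close>, so most arguments can
  be carried out with the real \<open>inner\<close> alone.\<close>

lemma Im_cinner: "Im (cinner x y) = inner x (\<i> *\<^sub>C y)"
  by (simp add: Re_cinner[symmetric] cinner_scaleC_right)

lemma inner_scaleC_left: "inner (c *\<^sub>C x) y = inner x (cnj c *\<^sub>C y)"
  by (simp add: Re_cinner[symmetric] cinner_scaleC_right cinner_scaleC_left)

lemma norm_scaleC: "norm (c *\<^sub>C x) = cmod c * norm x"
proof -
  have "complex_of_real ((norm (c *\<^sub>C x))\<^sup>2) = complex_of_real ((cmod c * norm x)\<^sup>2)"
    by (simp only: cinner_self[symmetric] cinner_scaleC_left cinner_scaleC_right)
       (simp add: cinner_self power_mult_distrib mult.assoc[symmetric] complex_norm_square del: of_real_power)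
  then show ?thesis
    by (simp only: of_real_eq_iff power2_eq_iff_nonneg norm_ge_zero mult_nonneg_nonneg)
qed

lemma bounded_linear_scaleC: "bounded_linear (\<lambda>x. c *\<^sub>C x)"
proof (rule bounded_linear_intro)
  fix r x
  show "c *\<^sub>C r *\<^sub>R x = r *\<^sub>R c *\<^sub>C x"
    by (simp add: scaleC_of_real[symmetric] scaleC_scaleC mult.commute)
  show "norm (c *\<^sub>C x) \<le> norm x * cmod c"
    by (simp add: norm_scaleC mult.commute)
qed (rule scaleC_add_right)

lemma scaleC_diff_right: "c *\<^sub>C (x - y) = c *\<^sub>C x - c *\<^sub>C y"
  by (rule linear_diff[OF bounded_linear.linear[OF bounded_linear_scaleC]])

lemma scaleC_scaleR_commute: "c *\<^sub>C r *\<^sub>R x = r *\<^sub>R c *\<^sub>C x"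
  by (rule linear_scale[OF bounded_linear.linear[OF bounded_linear_scaleC]])

text \<open>The real identity at \<open>\<i> *\<^sub>C y\<close> gives equality of the imaginary
  parts.\<close>

lemma selfadjoint_iff_inner:
  assumes "\<And>c x. A (c *\<^sub>C x) = c *\<^sub>C A x"
  shows "selfadjoint A \<longleftrightarrow> (\<forall>x y. inner (A x) y = inner x (A y))"
proof
  assume "selfadjoint A"
  then show "\<forall>x y. inner (A x) y = inner x (A y)"
    by (metis Re_cinner is_adjoint_def selfadjoint_def)
next
  assume *: "\<forall>x y. inner (A x) y = inner x (A y)"
  show "selfadjoint A"
    unfolding selfadjoint_def is_adjoint_def
  proof (intro allI complex_eqI)
    fix x y
    show "Re (cinner (A x) y) = Re (cinner x (A y))"
      using * by (simp add: Re_cinner)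
    show "Im (cinner (A x) y) = Im (cinner x (A y))"
      using * assms by (simp add: Im_cinner)
  qed
qed

lemma bounded_clinear_diff_fun:
  assumes "bounded_clinear A" "bounded_clinear B"
  shows "bounded_clinear (\<lambda>x. A x - B x)"
  using assms by (simp add: bounded_clinear_def bounded_linear_sub scaleC_diff_right)

text \<open>On a complex space a form that is real on the diagonal comes from a selfadjoint
  operator, by polarisation.\<close>

lemma positive_op_iff:
  "positive_op A \<longleftrightarrow> bounded_clinear A \<and> selfadjoint A \<and> (\<forall>x. inner (A x) x \<ge> 0)"
proof
  assume A: "positive_op A"
  then have lin: "bounded_linear A" and sc: "\<And>c x. A (c *\<^sub>C x) = c *\<^sub>C A x"
    by (auto simp: positive_op_def bounded_clinear_def)
  have add: "A (x + y) = A x + A y" for x y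
    by (rule linear_add[OF bounded_linear.linear[OF lin]])
  have im: "Im (cinner (A x) x) = 0" and re: "inner (A x) x \<ge> 0" for x
    using A by (auto simp: positive_op_def complex_nonneg_Reals_iff Re_cinner)
  have im0: "Im (cinner (A x) y) + Im (cinner (A y) x) = 0" for x y
    using im[of "x + y"] im[of x] im[of y]
    by (simp add: add cinner_add_left cinner_add_right)
  \<comment> \<open>Replacing \<open>x\<close> by \<open>\<i> *\<^sub>C x\<close> in
    \<open>im0\<close> turns the sum of imaginary parts into a difference of real parts.\<close>
  have "Re (cinner (A x) y) = Re (cinner (A y) x)" for x y
    using im0[of "\<i> *\<^sub>C x" y] by (simp add: sc cinner_scaleC_left cinner_scaleC_right)
  then have "inner (A x) y = inner x (A y)" for x y
    by (metis Re_cinner inner_commute)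
  then show "bounded_clinear A \<and> selfadjoint A \<and> (\<forall>x. inner (A x) x \<ge> 0)"
    using A re sc by (simp add: positive_op_def selfadjoint_iff_inner)
next
  assume A: "bounded_clinear A \<and> selfadjoint A \<and> (\<forall>x. inner (A x) x \<ge> 0)"
  have "cinner (A x) x \<in> \<real>\<^sub>\<ge>\<^sub>0" for x
  proof -
    have "cinner (A x) x = cnj (cinner (A x) x)"
      using A by (metis cinner_commute is_adjoint_def selfadjoint_def)
    then have "Im (cinner (A x) x) = 0"
      by (simp add: complex_eq_iff)
    with A show ?thesis
      by (simp add: complex_nonneg_Reals_iff Re_cinner)
  qed
  with A show "positive_op A"
    by (simp add: positive_op_def)
qed

text \<open>The form of \<open>A\<close> is nonnegative at \<open>x - t *\<^sub>R A x\<close>. The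
  estimate serves to bound \<open>1 - A / K\<close> by one and to show that \<open>A x = 0\<close>
  once \<open>inner (A x) x = 0\<close>.\<close>

lemma positive_op_norm_square_le:
  assumes lin: "bounded_linear A" and sym: "\<And>x y. inner (A x) y = inner x (A y)"
    and pos: "\<And>x. inner (A x) x \<ge> 0"
    and K: "K > 0" "\<And>x. norm (A x) \<le> K * norm x"
  shows "(norm (A x))\<^sup>2 \<le> K * inner (A x) x"
proof -
  interpret A: bounded_linear A by (rule lin)
  \<comment> \<open>This value minimises \<open>K * t\<^sup>2 - 2 * t\<close>, the coefficient of
    \<open>(norm (A x))\<^sup>2\<close> once \<open>inner (A (A x)) (A x)\<close> has been
    estimated.\<close>
  define t where "t = inverse K"
  have "inner (A (A x)) (A x) \<le> K * (norm (A x))\<^sup>2"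
    using norm_cauchy_schwarz[of "A (A x)" "A x"] mult_right_mono[OF K(2)[of "A x"] norm_ge_zero[of "A x"]]
    by (simp add: power2_eq_square)
  then have "t\<^sup>2 * inner (A (A x)) (A x) \<le> t\<^sup>2 * (K * (norm (A x))\<^sup>2)"
    by (rule mult_left_mono) simp
  also have "\<dots> = t * (norm (A x))\<^sup>2"
    using K(1) by (simp add: t_def power2_eq_square)
  finally have 1: "t\<^sup>2 * inner (A (A x)) (A x) \<le> t * (norm (A x))\<^sup>2" .
  have "0 \<le> inner (A (x - t *\<^sub>R A x)) (x - t *\<^sub>R A x)"
    by (rule pos)
  also have "\<dots> = inner (A x) x - 2 * (t * (norm (A x))\<^sup>2) + t\<^sup>2 * inner (A (A x)) (A x)"
    by (simp add: A.diff A.scaleR inner_diff_left inner_diff_right sym[of "A x" x]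
        power2_norm_eq_inner power2_eq_square[of t] algebra_simps)
  finally have "t * (norm (A x))\<^sup>2 \<le> inner (A x) x"
    using 1 by linarith
  then show ?thesis
    using K(1) by (simp add: t_def field_simps)
qed

section \<open>The positive square root\<close>

text \<open>
  The iteration \<open>Y \<mapsto> (B + Y\<^sup>2) / 2\<close> is dominated in norm, increment by increment, by the same
  scalar iteration started with \<open>B = 1\<close>, which increases to \<open>1\<close>. The induction principle in the
  conclusion transports closed properties from the iterates to the limit.
\<close>

lemma blinfun_quadratic_fixpoint:
  fixes B :: "'a::banach \<Rightarrow>\<^sub>L 'a"
  assumes B: "norm B \<le> 1"
  obtains Y where "Y = (1/2) *\<^sub>R (B + (Y o\<^sub>L Y))" "norm Y \<le> 1"
    "\<And>P. closed {Z. P Z} \<Longrightarrow> P 0 \<Longrightarrow> (\<And>Z. P Z \<Longrightarrow> P ((1/2) *\<^sub>R (B + (Z o\<^sub>L Z)))) \<Longrightarrow> P Y"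
proof -
  define F where "F Z = (1/2) *\<^sub>R (B + (Z o\<^sub>L Z))" for Z
  define f where "f z = (1 + z\<^sup>2) / 2" for z :: real
  define Y where "Y n = (F ^^ n) 0" for n
  define y where "y n = (f ^^ n) 0" for n
  have Y0: "Y 0 = 0"
    by (simp add: Y_def)
  have YS: "Y (Suc n) = F (Y n)" and yS: "y (Suc n) = f (y n)" for n
    by (simp_all add: Y_def y_def)
  have y01: "0 \<le> y n \<and> y n \<le> 1" for n
  proof (induction n)
    case (Suc n)
    then have "(y n)\<^sup>2 \<le> 1"
      by (simp add: power_le_one)
    then show ?case
      by (simp add: yS f_def)
  qed (simp add: y_def)
  have nY: "norm (Y n) \<le> y n" for n
  proof (induction n)
    case (Suc n)
    have "norm (Y n o\<^sub>L Y n) \<le> y n * y n"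
      using norm_blinfun_compose[of "Y n" "Y n"] mult_mono[OF Suc Suc] y01[of n]
      by (smt (verit) norm_ge_zero)
    then show ?case
      using norm_triangle_ineq[of B "Y n o\<^sub>L Y n"] B
      by (simp add: YS yS F_def f_def power2_eq_square)
  qed (simp add: Y_def y_def)
  have step: "norm (Y (Suc n) - Y n) \<le> y (Suc n) - y n" for n
  proof (induction n)
    case 0
    show ?case using B by (simp add: Y_def y_def F_def f_def)
  next
    case (Suc n)
    let ?D = "Y (Suc n) - Y n"
    \<comment> \<open>\<open>W\<close> and \<open>V\<close> need not commute, so the difference of
      squares is split by inserting \<open>W o\<^sub>L V\<close>.\<close>
    have "F W - F V = (1/2) *\<^sub>R ((W o\<^sub>L (W - V)) + ((W - V) o\<^sub>L V))" for W V
      by (rule blinfun_eqI) (simp add: F_def blinfun.bilinear_simps algebra_simps)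
    from this[of "Y (Suc n)" "Y n"]
    have "Y (Suc (Suc n)) - Y (Suc n) = (1/2) *\<^sub>R ((Y (Suc n) o\<^sub>L ?D) + (?D o\<^sub>L Y n))"
      by (simp only: YS)
    also have "norm \<dots> \<le> (1/2) * (norm (Y (Suc n)) * norm ?D + norm ?D * norm (Y n))"
      using norm_triangle_ineq[of "Y (Suc n) o\<^sub>L ?D" "?D o\<^sub>L Y n"]
        norm_blinfun_compose[of "Y (Suc n)" ?D] norm_blinfun_compose[of ?D "Y n"] by simp
    also have "\<dots> \<le> (1/2) * (y (Suc n) * (y (Suc n) - y n) + (y (Suc n) - y n) * y n)"
      using Suc nY[of n] nY[of "Suc n"] y01[of n] y01[of "Suc n"] order_trans[OF norm_ge_zero Suc]
      by (intro mult_left_mono add_mono mult_mono) auto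
    also have "\<dots> = y (Suc (Suc n)) - y (Suc n)"
      by (simp add: yS[of "Suc n"] f_def) (simp add: yS f_def power2_eq_square field_simps)
    finally show ?case .
  qed
  have mono: "y n \<le> y (Suc n)" for n
    using order_trans[OF norm_ge_zero step[of n]] by simp
  have "convergent y"
    using y01 mono by (intro Bseq_mono_convergent BseqI'[of _ 1]) (auto simp: lift_Suc_mono_le)
  \<comment> \<open>The increments of the convergent scalar sequence telescope, so they form a
    summable majorant for those of \<open>Y\<close>.\<close>
  then have "summable (\<lambda>n. y (Suc n) - y n)"
    using telescope_summable by (auto simp: convergent_def)
  then have "summable (\<lambda>n. Y (Suc n) - Y n)"
    using step by (rule summable_comparison_test')
  then have "convergent (\<lambda>n. \<Sum>k<n. Y (Suc k) - Y k)"
    by (simp add: summable_iff_convergent)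
  then have "convergent Y"
    by (simp add: sum_lessThan_telescope Y0)
  then obtain L where L: "Y \<longlonglongrightarrow> L"
    by (auto simp: convergent_def)
  have P: "P L" if "closed {Z. P Z}" "P 0" "\<And>Z. P Z \<Longrightarrow> P (F Z)" for P
  proof -
    have "P (Y n)" for n
      using that by (induction n) (simp_all add: Y_def)
    then show ?thesis
      using closed_sequentially[OF that(1) _ L] by simp
  qed
  have "(\<lambda>n. F (Y n)) \<longlonglongrightarrow> F L"
    unfolding F_def by (intro tendsto_intros L bounded_bilinear.tendsto[OF bounded_bilinear_blinfun_compose])
  moreover have "(\<lambda>n. F (Y n)) \<longlonglongrightarrow> L"
    using LIMSEQ_Suc[OF L] by (simp add: YS)
  ultimately have "F L = L"
    by (rule LIMSEQ_unique)
  moreover have "norm L \<le> 1"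
    by (rule LIMSEQ_le_const2[OF tendsto_norm[OF L]]) (use nY y01 in \<open>blast intro: order_trans\<close>)
  ultimately show ?thesis
    using that[of L] P by (auto simp: F_def)
qed

text \<open>Put \<open>B = 1 - A / K\<close>. A solution of \<open>Y = (B + Y\<^sup>2) / 2\<close>
  satisfies \<open>(1 - Y)\<^sup>2 = 1 - B = A / K\<close>, so \<open>sqrt K * (1 - Y)\<close> is a
  root of \<open>A\<close>, positive because \<open>norm Y \<le> 1\<close>. The commutation clause
  is there for the uniqueness of the root.\<close>

lemma positive_op_sqrt_exists:
  fixes A :: "'a::chilbert_space \<Rightarrow> 'a"
  assumes "positive_op A"
  obtains R where "positive_op R" "R \<circ> R = A"
    "\<And>C. bounded_linear C \<Longrightarrow> C \<circ> A = A \<circ> C \<Longrightarrow> C \<circ> R = R \<circ> C"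
proof -
  have lin: "bounded_linear A" and sc: "A (c *\<^sub>C x) = c *\<^sub>C A x"
    and sym: "inner (A x) y = inner x (A y)" and pos: "inner (A x) x \<ge> 0" for c x y
    using assms selfadjoint_iff_inner[of A] by (auto simp: positive_op_iff bounded_clinear_def)
  interpret A: bounded_linear A by (rule lin)
  obtain K where K: "K > 0" "\<And>x. norm (A x) \<le> K * norm x"
    using A.pos_bounded by (auto simp: mult.commute)
  have bl: "bounded_linear (\<lambda>x. x - inverse K *\<^sub>R A x)"
    by (intro bounded_linear_sub bounded_linear_ident bounded_linear_const_scaleR lin)
  define B where "B = Blinfun (\<lambda>x. x - inverse K *\<^sub>R A x)"
  have B: "blinfun_apply B x = x - inverse K *\<^sub>R A x" for x
    by (simp add: B_def bounded_linear_Blinfun_apply[OF bl])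
  have "norm B \<le> 1"
  proof (rule norm_blinfun_bound)
    fix x
    \<comment> \<open>This absorbs the quadratic term of the expansion below into half of the linear
      one; the triangle inequality alone would give the bound 2.\<close>
    have le: "(norm (A x))\<^sup>2 \<le> K * inner (A x) x"
      by (rule positive_op_norm_square_le[OF lin sym pos K])
    have "(norm (x - inverse K *\<^sub>R A x))\<^sup>2
        = (norm x)\<^sup>2 - 2 * (inverse K * inner (A x) x) + (inverse K)\<^sup>2 * (norm (A x))\<^sup>2"
      by (simp add: power2_norm_eq_inner inner_diff_left inner_diff_right inner_commute
          power2_eq_square[of "inverse K"] algebra_simps)
    also have "\<dots> \<le> (norm x)\<^sup>2 - 2 * (inverse K * inner (A x) x)
        + (inverse K)\<^sup>2 * (K * inner (A x) x)"
      using le by (intro add_left_mono mult_left_mono) auto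
    also have "\<dots> = (norm x)\<^sup>2 - inverse K * inner (A x) x"
      using K(1) by (simp add: power2_eq_square)
    also have "\<dots> \<le> (norm x)\<^sup>2"
      using K(1) pos[of x] by simp
    finally show "norm (blinfun_apply B x) \<le> 1 * norm x"
      by (simp add: B)
  qed simp
  then obtain Y where Y: "Y = (1/2) *\<^sub>R (B + (Y o\<^sub>L Y))" "norm Y \<le> 1"
    and ind: "\<And>P. closed {Z. P Z} \<Longrightarrow> P 0 \<Longrightarrow> (\<And>Z. P Z \<Longrightarrow> P ((1/2) *\<^sub>R (B + (Z o\<^sub>L Z)))) \<Longrightarrow> P Y"
    by (rule blinfun_quadratic_fixpoint) (rule that, assumption, assumption, blast)
  \<comment> \<open>The type \<open>'a \<Rightarrow>\<^sub>L 'a\<close> records real linearity only,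
    so complex homogeneity is carried to the limit separately.\<close>
  have Ysc: "\<forall>c x. blinfun_apply Y (c *\<^sub>C x) = c *\<^sub>C blinfun_apply Y x"
  proof (rule ind)
    show "closed {Z::'a \<Rightarrow>\<^sub>L 'a. \<forall>c x. blinfun_apply Z (c *\<^sub>C x) = c *\<^sub>C blinfun_apply Z x}"
      by (intro closed_Collect_all closed_Collect_eq continuous_intros
          bounded_linear.continuous_on[OF bounded_linear_scaleC])
  qed (simp_all add: blinfun.bilinear_simps B sc scaleC_add_right scaleC_diff_right
      scaleC_scaleR_commute linear_0[OF bounded_linear.linear[OF bounded_linear_scaleC]])
  have Ysym: "\<forall>x y. inner (blinfun_apply Y x) y = inner x (blinfun_apply Y y)"
  proof (rule ind)
    show "closed {Z::'a \<Rightarrow>\<^sub>L 'a. \<forall>x y. inner (blinfun_apply Z x) y = inner x (blinfun_apply Z y)}"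
      by (intro closed_Collect_all closed_Collect_eq continuous_intros)
  qed (simp_all add: blinfun.bilinear_simps B sym inner_add_left inner_add_right
      inner_diff_left inner_diff_right)
  have Ycomm: "\<forall>x. C (blinfun_apply Y x) = blinfun_apply Y (C x)"
    if C: "bounded_linear C" "C \<circ> A = A \<circ> C" for C
  proof (rule ind)
    interpret C: bounded_linear C by (rule C(1))
    show "closed {Z::'a \<Rightarrow>\<^sub>L 'a. \<forall>x. C (blinfun_apply Z x) = blinfun_apply Z (C x)}"
      by (intro closed_Collect_all closed_Collect_eq continuous_intros C.continuous_on)
    show "\<forall>x. C (blinfun_apply 0 x) = blinfun_apply 0 (C x)"
      by (simp add: C.zero)
    show "\<forall>x. C (blinfun_apply ((1/2) *\<^sub>R (B + (Z o\<^sub>L Z))) x)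
        = blinfun_apply ((1/2) *\<^sub>R (B + (Z o\<^sub>L Z))) (C x)"
      if "\<forall>x. C (blinfun_apply Z x) = blinfun_apply Z (C x)" for Z
      using that fun_cong[OF C(2)]
      by (simp add: blinfun.bilinear_simps B C.add C.diff C.scaleR)
  qed
  define R where "R x = sqrt K *\<^sub>R (x - blinfun_apply Y x)" for x
  have Rlin: "bounded_linear R"
    unfolding R_def
    by (intro bounded_linear_const_scaleR bounded_linear_sub bounded_linear_ident blinfun.bounded_linear_right)
  have Rsc: "R (c *\<^sub>C x) = c *\<^sub>C R x" for c x
    using Ysc by (simp add: R_def scaleC_scaleR_commute scaleC_diff_right)
  have Rpos: "inner (R x) x \<ge> 0" for x
  proof -
    have "inner (blinfun_apply Y x) x \<le> norm (blinfun_apply Y x) * norm x"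
      by (rule norm_cauchy_schwarz)
    also have "\<dots> \<le> (1 * norm x) * norm x"
      by (intro mult_right_mono order_trans[OF norm_blinfun] Y(2)) auto
    finally show ?thesis
      using K(1) by (simp add: R_def inner_diff_left power2_norm_eq_inner[symmetric] power2_eq_square)
  qed
  show ?thesis
  proof
    show "positive_op R"
      using Rlin Rsc Rpos Ysym selfadjoint_iff_inner[of R]
      by (simp add: positive_op_iff bounded_clinear_def)
         (simp add: R_def inner_diff_left inner_diff_right)
    show "R \<circ> R = A"
    proof
      fix x
      have "blinfun_apply Y x = (1/2) *\<^sub>R (blinfun_apply B x + blinfun_apply Y (blinfun_apply Y x))"
        using arg_cong[OF Y(1), of "\<lambda>Z. blinfun_apply Z x"] by (simp add: blinfun.bilinear_simps)
      then have "2 *\<^sub>R blinfun_apply Y x = blinfun_apply B x + blinfun_apply Y (blinfun_apply Y x)"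
        by (metis scaleR_half_double scaleR_2 scaleR_add_right)
      moreover have "sqrt K *\<^sub>R sqrt K *\<^sub>R v = K *\<^sub>R v" for v :: 'a
        using K(1) by simp
      then have "(R \<circ> R) x = K *\<^sub>R (x - 2 *\<^sub>R blinfun_apply Y x + blinfun_apply Y (blinfun_apply Y x))"
        by (simp add: R_def blinfun.bilinear_simps scaleR_2 algebra_simps del: scaleR_scaleR)
      ultimately show "(R \<circ> R) x = A x"
        using K(1) by (simp add: B)
    qed
    show "C \<circ> R = R \<circ> C" if C: "bounded_linear C" "C \<circ> A = A \<circ> C" for C
    proof
      fix x
      interpret C: bounded_linear C by (rule C(1))
      show "(C \<circ> R) x = (R \<circ> C) x"
        using Ycomm[OF C] by (simp add: R_def C.scaleR C.diff)
    qed
  qed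
qed

section \<open>Uniqueness of the positive square root\<close>

lemma positive_op_null:
  assumes "positive_op A" "inner (A x) x = 0"
  shows "A x = 0"
proof -
  have lin: "bounded_linear A" and sym: "inner (A x) y = inner x (A y)"
    and pos: "inner (A x) x \<ge> 0" for x y
    using assms(1) selfadjoint_iff_inner[of A] by (auto simp: positive_op_iff bounded_clinear_def)
  obtain K where K: "K > 0" "\<And>x. norm (A x) \<le> K * norm x"
    using bounded_linear.pos_bounded[OF lin] by (auto simp: mult.commute)
  show ?thesis
    using positive_op_norm_square_le[OF lin sym pos K, of x] assms(2) by simp
qed

text \<open>For \<open>y = R x - S x\<close>, commutation gives
  \<open>R y + S y = R (R x) - S (S x) = 0\<close>. Two nonnegative forms that add up to zero at
  \<open>y\<close> both vanish there, hence \<open>R y = S y = 0\<close>.\<close>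

lemma positive_op_sqrt_unique:
  fixes R S :: "'a::chilbert_space \<Rightarrow> 'a"
  assumes R: "positive_op R" and S: "positive_op S" and eq: "R \<circ> R = S \<circ> S"
    and comm: "S \<circ> R = R \<circ> S"
  shows "R = S"
proof
  fix x
  interpret R: bounded_linear R
    using R by (simp add: positive_op_iff bounded_clinear_def)
  interpret S: bounded_linear S
    using S by (simp add: positive_op_iff bounded_clinear_def)
  have sym: "inner (R u) v = inner u (R v)" "inner (S u) v = inner u (S v)" for u v
    using R S selfadjoint_iff_inner[of R] selfadjoint_iff_inner[of S]
    by (auto simp: positive_op_iff bounded_clinear_def)
  define y where "y = R x - S x"
  have "R y + S y = 0"
    using fun_cong[OF eq, of x] fun_cong[OF comm, of x] by (simp add: y_def R.diff S.diff)
  then have "inner (R y) y + inner (S y) y = 0"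
    by (simp add: inner_add_left[symmetric])
  moreover have "inner (R y) y \<ge> 0" "inner (S y) y \<ge> 0"
    using R S by (auto simp: positive_op_iff)
  ultimately have "R y = 0" "S y = 0"
    using positive_op_null[OF R, of y] positive_op_null[OF S, of y] by linarith+
  \<comment> \<open>Only the left \<open>y\<close> is unfolded, so that symmetry moves
    \<open>R\<close> and \<open>S\<close> onto the right one, which both of them kill.\<close>
  then have "inner y y = 0"
    using sym[of x y] by (simp add: y_def[THEN arg_cong, of "\<lambda>z. inner z y"] inner_diff_left)
  then show "R x = S x"
    by (simp add: y_def)
qed

text \<open>Another root \<open>S\<close> commutes with \<open>A = S \<circ> S\<close>, hence with
  the constructed \<open>R\<close>, and so equals it. The description in \<open>op_sqrt_def\<close>
  is therefore proper.\<close>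

lemma op_sqrt:
  fixes A :: "'a::chilbert_space \<Rightarrow> 'a"
  assumes "positive_op A"
  shows "positive_op (op_sqrt A)" "op_sqrt A \<circ> op_sqrt A = A"
proof -
  obtain R where R: "positive_op R" "R \<circ> R = A"
    and comm: "\<And>C. bounded_linear C \<Longrightarrow> C \<circ> A = A \<circ> C \<Longrightarrow> C \<circ> R = R \<circ> C"
    using positive_op_sqrt_exists[OF assms] by blast
  have "S = R" if S: "positive_op S \<and> S \<circ> S = A" for S
  proof (rule positive_op_sqrt_unique[symmetric])
    have "S \<circ> A = A \<circ> S"
      using S by (metis comp_assoc)
    then show "S \<circ> R = R \<circ> S"
      using S by (intro comm) (auto simp: positive_op_iff bounded_clinear_def)
  qed (use R S in auto)
  with R have "\<exists>!R. positive_op R \<and> R \<circ> R = A"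
    by blast
  from theI'[OF this] show "positive_op (op_sqrt A)" "op_sqrt A \<circ> op_sqrt A = A"
    by (auto simp: op_sqrt_def)
qed

section \<open>Factorization through a positive operator\<close>

text \<open>
  The representing vector is the limit of \<open>R y\<close> along a sequence minimising
  \<open>y \<mapsto> \<parallel>R y\<parallel>\<^sup>2 / 2 - f y\<close>. The case \<open>R = id\<close> is the Riesz representation theorem.
\<close>

lemma riesz_along_range:
  fixes R :: "'a::real_vector \<Rightarrow> 'b::{real_inner, complete_space}" and f :: "'a \<Rightarrow> real"
  assumes R: "linear R" and f: "linear f" and k: "k \<ge> 0"
    and bound: "\<And>y. \<bar>f y\<bar> \<le> k * norm (R y)"
  shows "\<exists>w \<in> closure (range R). (\<forall>y. inner w (R y) = f y) \<and> norm w \<le> k"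
proof -
  interpret R: linear R by (rule R)
  interpret f: linear f by (rule f)
  define \<phi> where "\<phi> y = (norm (R y))\<^sup>2 / 2 - f y" for y
  define m where "m = (INF y. \<phi> y)"
  have "- (k\<^sup>2 / 2) \<le> \<phi> y" for y
  proof -
    have "0 \<le> (norm (R y) - k)\<^sup>2" by simp
    then show ?thesis
      using bound[of y] by (simp add: \<phi>_def power2_diff mult.commute)
  qed
  then have bdd: "bdd_below (range \<phi>)"
    by (rule bdd_belowI2)
  then have m: "m \<le> \<phi> y" for y
    unfolding m_def by (rule cINF_lower) simp
  have "\<exists>y. \<phi> y < m + inverse (real (Suc n))" for n
  proof -
    have "Inf (range \<phi>) < m + inverse (real (Suc n))"
      by (simp add: m_def)
    then show ?thesis
      using bdd by (subst (asm) cInf_less_iff) auto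
  qed
  then obtain Y where Y: "\<And>n. \<phi> (Y n) < m + inverse (real (Suc n))"
    by metis
  \<comment> \<open>The parallelogram law; the linear part of \<open>\<phi>\<close> cancels at the
    midpoint. Points where \<open>\<phi>\<close> is almost minimal thus have close images under
    \<open>R\<close>.\<close>
  have par: "(norm (R a - R b))\<^sup>2 = 4 * (\<phi> a + \<phi> b - 2 * \<phi> ((1/2) *\<^sub>R (a + b)))" for a b
    by (simp add: \<phi>_def R.scale R.add f.scale f.add power2_norm_eq_inner inner_diff_left
        inner_diff_right inner_add_left inner_add_right inner_commute algebra_simps)
  have "Cauchy (\<lambda>n. R (Y n))"
  proof (rule CauchyI)
    fix e :: real
    assume "e > 0"
    then have "e\<^sup>2 / 8 > 0" by simp
    \<comment> \<open>With both values below \<open>m + e\<^sup>2 / 8\<close> and the midpoint value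
      at least \<open>m\<close>, the right side of \<open>par\<close> stays below
      \<open>e\<^sup>2\<close>.\<close>
    then obtain M where M: "inverse (real (Suc M)) < e\<^sup>2 / 8"
      using reals_Archimedean by blast
    have "norm (R (Y i) - R (Y j)) < e" if "i \<ge> M" "j \<ge> M" for i j
    proof -
      have "inverse (real (Suc i)) \<le> inverse (real (Suc M))"
           "inverse (real (Suc j)) \<le> inverse (real (Suc M))"
        using that by (simp_all add: field_simps)
      then have "\<phi> (Y i) < m + e\<^sup>2 / 8" "\<phi> (Y j) < m + e\<^sup>2 / 8"
        using Y[of i] Y[of j] M by linarith+
      then have "(norm (R (Y i) - R (Y j)))\<^sup>2 < e\<^sup>2"
        unfolding par using m[of "(1/2) *\<^sub>R (Y i + Y j)"] by argo
      with \<open>e > 0\<close> show ?thesis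
        by (simp add: power2_less_imp_less)
    qed
    then show "\<exists>M. \<forall>i\<ge>M. \<forall>j\<ge>M. norm (R (Y i) - R (Y j)) < e"
      by blast
  qed
  then obtain w where w: "(\<lambda>n. R (Y n)) \<longlonglongrightarrow> w"
    using Cauchy_convergent_iff by (auto simp: convergent_def)
  have \<phi>Y: "(\<lambda>n. \<phi> (Y n)) \<longlonglongrightarrow> m"
  proof (rule tendsto_sandwich[where f = "\<lambda>_. m" and h = "\<lambda>n. m + inverse (real (Suc n))"])
    show "(\<lambda>n. m + inverse (real (Suc n))) \<longlonglongrightarrow> m"
      using tendsto_add[OF tendsto_const LIMSEQ_inverse_real_of_nat, of m] by simp
    show "\<forall>\<^sub>F n in sequentially. m \<le> \<phi> (Y n)"
      using m by (intro always_eventually allI)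
    show "\<forall>\<^sub>F n in sequentially. \<phi> (Y n) \<le> m + inverse (real (Suc n))"
      using Y less_imp_le by (intro always_eventually allI) blast
  qed simp
  have rep: "inner w (R y) = f y" for y
  proof -
    define c where "c = inner w (R y) - f y"
    define q where "q = (norm (R y))\<^sup>2 / 2"
    have q: "q \<ge> 0" by (simp add: q_def)
    \<comment> \<open>First variation. The limit \<open>w\<close> need not lie in the range of
      \<open>R\<close>, so minimality is used at \<open>Y n + t *\<^sub>R y\<close> and passed to
      the limit.\<close>
    have *: "0 \<le> t * c + t\<^sup>2 * q" for t
    proof -
      have "m \<le> \<phi> (Y n) + t * (inner (R (Y n)) (R y) - f y) + t\<^sup>2 * q" for n
        using m[of "Y n + t *\<^sub>R y"]
        by (simp add: \<phi>_def q_def R.scale R.add f.scale f.add power2_norm_eq_inner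
            inner_add_left inner_add_right inner_commute algebra_simps power2_eq_square[of t] add_divide_distrib)
      moreover have "(\<lambda>n. \<phi> (Y n) + t * (inner (R (Y n)) (R y) - f y) + t\<^sup>2 * q)
          \<longlonglongrightarrow> m + t * c + t\<^sup>2 * q"
        unfolding c_def by (intro tendsto_intros \<phi>Y w)
      ultimately have "m \<le> m + t * c + t\<^sup>2 * q"
        using LIMSEQ_le_const by blast
      then show ?thesis by simp
    qed
    \<comment> \<open>At \<open>t = - s\<close> the expression in \<open>*\<close> becomes
      \<open>- s\<^sup>2\<close>. Adding 1 keeps the denominator positive when
      \<open>R y = 0\<close>.\<close>
    define s where "s = c / (q + 1)"
    have c: "c = s * (q + 1)"
      using q by (simp add: s_def)
    have "0 \<le> - s * c + (- s)\<^sup>2 * q"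
      by (rule *)
    also have "\<dots> = - s\<^sup>2"
      by (simp add: c power2_eq_square algebra_simps)
    finally have "s = 0"
      by simp
    then have "c = 0"
      by (simp add: c)
    then show ?thesis
      by (simp add: c_def)
  qed
  \<comment> \<open>The bound on \<open>f\<close> is inherited by \<open>w\<close> as the limit of
    \<open>R (Y n)\<close>, since \<open>inner w (R (Y n)) = f (Y n)\<close>.\<close>
  have "inner w w \<le> k * norm w"
  proof (rule LIMSEQ_le)
    show "(\<lambda>n. inner w (R (Y n))) \<longlonglongrightarrow> inner w w" "(\<lambda>n. k * norm (R (Y n))) \<longlonglongrightarrow> k * norm w"
      by (intro tendsto_intros w)+
    show "\<exists>N. \<forall>n\<ge>N. inner w (R (Y n)) \<le> k * norm (R (Y n))"
      using bound by (auto simp: rep abs_le_iff)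
  qed
  then have "norm w \<le> k"
    using k by (cases "w = 0") (auto simp: power2_norm_eq_inner[symmetric] power2_eq_square)
  moreover have "w \<in> closure (range R)"
    unfolding closure_sequential using w by (intro exI[of _ "\<lambda>n. R (Y n)"]) auto
  ultimately show ?thesis
    using rep by blast
qed

section \<open>Closures of operator ranges\<close>

lemma orthogonal_closure_range:
  assumes "\<And>y. inner w (R y) = 0" "v \<in> closure (range R)"
  shows "inner w v = 0"
proof -
  have "closed {v. inner w v = 0}"
    by (intro closed_Collect_eq continuous_intros)
  then have "closure (range R) \<subseteq> {v. inner w v = 0}"
    using assms(1) by (intro closure_minimal) auto
  with assms(2) show ?thesis by blast
qed

lemma subspace_closure:
  fixes S :: "'a::real_normed_vector set"
  assumes S: "subspace S"
  shows "subspace (closure S)"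
proof (rule subspaceI)
  show "0 \<in> closure S"
    using subspace_0[OF S] closure_subset by blast
next
  fix x y
  assume "x \<in> closure S" "y \<in> closure S"
  then obtain X Y where "\<And>n. X n \<in> S" "X \<longlonglongrightarrow> x" "\<And>n. Y n \<in> S" "Y \<longlonglongrightarrow> y"
    by (auto simp: closure_sequential)
  then have "\<forall>n. X n + Y n \<in> S" "(\<lambda>n. X n + Y n) \<longlonglongrightarrow> x + y"
    by (auto intro: subspace_add[OF S] tendsto_add)
  then show "x + y \<in> closure S"
    unfolding closure_sequential by (intro exI conjI)
next
  fix c :: real and x
  assume "x \<in> closure S"
  then obtain X where "\<And>n. X n \<in> S" "X \<longlonglongrightarrow> x"
    by (auto simp: closure_sequential)
  then have "\<forall>n. c *\<^sub>R X n \<in> S" "(\<lambda>n. c *\<^sub>R X n) \<longlonglongrightarrow> c *\<^sub>R x"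
    by (auto intro: subspace_scale[OF S] tendsto_scaleR)
  then show "c *\<^sub>R x \<in> closure S"
    unfolding closure_sequential by (intro exI conjI)
qed

text \<open>The difference lies in the closure and is orthogonal to the range, hence to itself. This
  uniqueness makes representing vectors additive and homogeneous.\<close>

lemma closure_range_eqI:
  assumes "linear R" "u \<in> closure (range R)" "v \<in> closure (range R)"
    and "\<And>y. inner u (R y) = inner v (R y)"
  shows "u = v"
proof -
  have "subspace (closure (range R))"
    using assms(1) by (intro subspace_closure linear_subspace_image subspace_UNIV)
  then have "u - v \<in> closure (range R)"
    using assms(2,3) by (rule subspace_diff)
  moreover have "inner (u - v) (R y) = 0" for y
    by (simp add: inner_diff_left assms(4))
  ultimately have "inner (u - v) (u - v) = 0"
    by (metis orthogonal_closure_range)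
  then show ?thesis by simp
qed

lemma closure_range_scaleC:
  assumes "\<And>c x. R (c *\<^sub>C x) = c *\<^sub>C R x" "u \<in> closure (range R)"
  shows "c *\<^sub>C u \<in> closure (range R)"
proof -
  have "(\<lambda>u. c *\<^sub>C u) ` closure (range R) \<subseteq> closure (range R)"
  proof (rule image_closure_subset)
    show "(\<lambda>u. c *\<^sub>C u) ` range R \<subseteq> closure (range R)"
      using closure_subset[of "range R"] by (auto simp: assms(1)[symmetric])
  qed (auto intro: bounded_linear.continuous_on[OF bounded_linear_scaleC] continuous_on_id)
  with assms(2) show ?thesis by blast
qed

text \<open>Allows \<Gamma> to be built on the closed range of the square root instead of that of
  \<open>T 0\<close>. The projection \<open>w\<close> of \<open>R x\<close> to the smaller closure
  differs from \<open>R x\<close> by a vector that \<open>R\<close> kills, and the kernel of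
  \<open>R\<close> is orthogonal to its range.\<close>

lemma closure_range_square:
  fixes R :: "'a::chilbert_space \<Rightarrow> 'a"
  assumes R: "positive_op R"
  shows "closure (range (R \<circ> R)) = closure (range R)"
proof
  show "closure (range (R \<circ> R)) \<subseteq> closure (range R)"
    by (intro closure_mono) auto
  have lin: "bounded_linear R" and sym: "inner (R x) y = inner x (R y)" for x y
    using R selfadjoint_iff_inner[of R] by (auto simp: positive_op_iff bounded_clinear_def)
  interpret R: bounded_linear R by (rule lin)
  have "R x \<in> closure (range (R \<circ> R))" for x
  proof -
    have "linear (R \<circ> R)" "linear (\<lambda>y. inner (R x) ((R \<circ> R) y))"
      by (auto intro!: linearI simp: R.add R.scaleR inner_add_right)
    from riesz_along_range[OF this norm_ge_zero Cauchy_Schwarz_ineq2]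
    obtain w where w: "w \<in> closure (range (R \<circ> R))"
      "\<And>y. inner w ((R \<circ> R) y) = inner (R x) ((R \<circ> R) y)"
      by auto
    define d where "d = w - R x"
    have "inner (R d) (R y) = 0" for y
      using w(2)[of y] by (simp add: d_def sym inner_diff_left)
    from this[of d] have "R d = 0" by simp
    then have "inner d (R y) = 0" for y
      using sym[of d] by simp
    then have "inner w (R y) = inner (R x) (R y)" for y
      by (simp add: d_def inner_diff_left)
    moreover have "w \<in> closure (range R)"
      using w(1) \<open>closure (range (R \<circ> R)) \<subseteq> closure (range R)\<close> by blast
    moreover have "R x \<in> closure (range R)"
      using closure_subset[of "range R"] by auto
    ultimately have "w = R x"
      by (rule closure_range_eqI[OF R.linear, rotated 2])
    with w(1) show ?thesis by simp
  qed
  then show "closure (range R) \<subseteq> closure (range (R \<circ> R))"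
    by (intro closure_minimal) auto
qed

section \<open>Contractions on a subspace\<close>

lemma contraction_on_norm_le:
  assumes "contraction_on M A" "x \<in> M"
  shows "norm (A x) \<le> norm x"
proof -
  obtain K where "\<forall>x\<in>M. norm (A x) \<le> norm x * K"
    using assms(1) by (auto simp: contraction_on_def bounded_clinear_on_def)
  then have K: "norm (A x) \<le> norm x * K" if "x \<in> M" for x
    using that by blast
  \<comment> \<open>A real \<open>SUP\<close> dominates its terms only if they are bounded above.
    The absolute value covers the quotient 0 at \<open>x = 0\<close>, since \<open>K\<close> may be
    negative when \<open>M\<close> is trivial.\<close>
  have "norm (A x) / norm x \<le> \<bar>K\<bar>" if "x \<in> M" for x
  proof (cases "x = 0")
    case False
    have "norm (A x) \<le> norm x * \<bar>K\<bar>"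
      by (rule order_trans[OF K[OF that]]) (simp add: mult_left_mono)
    with False show ?thesis
      by (simp add: field_simps)
  qed simp
  then have "bdd_above ((\<lambda>x. norm (A x) / norm x) ` M)"
    by (rule bdd_aboveI2)
  then have "norm (A x) / norm x \<le> onorm_on M A"
    unfolding onorm_on_def by (rule cSUP_upper2[OF _ assms(2)]) simp
  also have "\<dots> \<le> 1"
    using assms(1) by (simp add: contraction_on_def)
  \<comment> \<open>At \<open>x = 0\<close> the quotient carries no information; there
    \<open>K\<close> forces \<open>A x = 0\<close>.\<close>
  finally show ?thesis
    using K[OF assms(2)] by (cases "x = 0") (simp_all add: field_simps)
qed

text \<open>\<open>M\<close> is nonempty because the supremum of an empty set of reals is
  unspecified.\<close>

lemma contraction_onI:
  assumes "M \<noteq> {}" and "\<And>x. x \<in> M \<Longrightarrow> A x \<in> M"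
    and "\<And>x y. \<lbrakk>x \<in> M; y \<in> M\<rbrakk> \<Longrightarrow> A (x + y) = A x + A y"
    and "\<And>c x. x \<in> M \<Longrightarrow> A (c *\<^sub>C x) = c *\<^sub>C A x"
    and norm: "\<And>x. x \<in> M \<Longrightarrow> norm (A x) \<le> norm x"
  shows "contraction_on M A"
proof -
  have "onorm_on M A \<le> 1"
    unfolding onorm_on_def
  proof (rule cSUP_least)
    show "norm (A x) / norm x \<le> 1" if "x \<in> M" for x
      using norm[OF that] by (cases "x = 0") (simp_all add: field_simps)
  qed (rule assms(1))
  moreover have "bounded_clinear_on M A"
    using assms by (auto simp: bounded_clinear_on_def intro!: exI[of _ 1])
  ultimately show ?thesis
    by (simp add: contraction_on_def)
qed

text \<open>
  The Riesz lemma is applied twice: first to \<open>\<langle>T y, \<cdot>\<rangle>\<close>, which gives \<open>W y\<close> with \<open>R (W y) = T y\<close>,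
  then to \<open>\<langle>x, W \<cdot>\<rangle>\<close>, which gives \<open>\<Gamma> x\<close> on the whole space without an extension by continuity.
\<close>

lemma contraction_factorization:
  fixes R T :: "'a::chilbert_space \<Rightarrow> 'a"
  assumes R: "positive_op R" and T: "bounded_clinear T" "selfadjoint T"
    and bound: "\<And>x y. \<bar>inner (T x) y\<bar> \<le> norm (R x) * norm (R y)"
  obtains \<Gamma> where "contraction_on (closure (range R)) \<Gamma>" "T = R \<circ> \<Gamma> \<circ> R"
proof -
  let ?M = "closure (range R)"
  have Rlin: "bounded_linear R" and Rsc: "R (c *\<^sub>C x) = c *\<^sub>C R x"
    and Rsym: "inner (R x) y = inner x (R y)" for c x y
    using R selfadjoint_iff_inner[of R] by (auto simp: positive_op_iff bounded_clinear_def)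
  have Tlin: "bounded_linear T" and Tsc: "T (c *\<^sub>C x) = c *\<^sub>C T x"
    and Tsym: "inner (T x) y = inner x (T y)" for c x y
    using T selfadjoint_iff_inner[of T] by (auto simp: bounded_clinear_def)
  interpret R: bounded_linear R by (rule Rlin)
  interpret T: bounded_linear T by (rule Tlin)
  have M: "subspace ?M"
    by (intro subspace_closure linear_subspace_image subspace_UNIV R.linear)
  note Madd = subspace_add[OF M] and Mscale = subspace_scale[OF M]
    and MscaleC = closure_range_scaleC[OF Rsc] and eqI = closure_range_eqI[OF R.linear]
  have "\<forall>y. \<exists>w. w \<in> ?M \<and> (\<forall>z. inner w (R z) = inner (T y) z) \<and> norm w \<le> norm (R y)"
  proof
    fix y
    have "linear (\<lambda>z. inner (T y) z)"
      by (auto intro!: linearI simp: inner_add_right)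
    from riesz_along_range[OF R.linear this norm_ge_zero bound]
    show "\<exists>w. w \<in> ?M \<and> (\<forall>z. inner w (R z) = inner (T y) z) \<and> norm w \<le> norm (R y)"
      unfolding Bex_def .
  qed
  from choice[OF this] obtain W where W: "\<And>y. W y \<in> ?M" "\<And>y z. inner (W y) (R z) = inner (T y) z"
    "\<And>y. norm (W y) \<le> norm (R y)"
    by auto
  \<comment> \<open>Linearity of \<open>W\<close>, and later of \<Gamma>, holds because both sides
    represent the same functional along \<open>R\<close>.\<close>
  have Wadd: "W (x + y) = W x + W y" for x y
    by (intro eqI W(1) Madd) (simp add: W(2) T.add inner_add_left)
  have Wscale: "W (r *\<^sub>R x) = r *\<^sub>R W x" for r x
    by (intro eqI W(1) Mscale) (simp add: W(2) T.scaleR)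
  have WscaleC: "W (c *\<^sub>C x) = c *\<^sub>C W x" for c x
    by (intro eqI W(1) MscaleC) (simp add: inner_scaleC_left Rsc[symmetric] W(2) Tsc)
  have "\<forall>x. \<exists>w. w \<in> ?M \<and> (\<forall>y. inner w (R y) = inner x (W y)) \<and> norm w \<le> norm x"
  proof
    fix x
    have "linear (\<lambda>y. inner x (W y))"
      by (auto intro!: linearI simp: inner_add_right Wadd Wscale)
    \<comment> \<open>The bound \<open>norm (W y) \<le> norm (R y)\<close> is what makes
      \<open>R\<close> control this second functional, with constant \<open>norm x\<close>.\<close>
    moreover have "\<bar>inner x (W y)\<bar> \<le> norm x * norm (R y)" for y
      by (rule order_trans[OF Cauchy_Schwarz_ineq2 mult_left_mono[OF W(3) norm_ge_zero]])
    ultimately show "\<exists>w. w \<in> ?M \<and> (\<forall>y. inner w (R y) = inner x (W y)) \<and> norm w \<le> norm x"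
      unfolding Bex_def[symmetric] by (rule riesz_along_range[OF R.linear _ norm_ge_zero])
  qed
  from choice[OF this] obtain \<Gamma> where \<Gamma>: "\<And>x. \<Gamma> x \<in> ?M" "\<And>x y. inner (\<Gamma> x) (R y) = inner x (W y)"
    "\<And>x. norm (\<Gamma> x) \<le> norm x"
    by auto
  have "contraction_on ?M \<Gamma>"
  proof (rule contraction_onI)
    show "\<Gamma> (x + y) = \<Gamma> x + \<Gamma> y" for x y
      by (intro eqI \<Gamma>(1) Madd) (simp add: \<Gamma>(2) inner_add_left)
    show "\<Gamma> (c *\<^sub>C x) = c *\<^sub>C \<Gamma> x" for c x
      by (intro eqI \<Gamma>(1) MscaleC)
        (simp add: inner_scaleC_left Rsc[symmetric] \<Gamma>(2) WscaleC[symmetric])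
  qed (use \<Gamma> in auto)
  moreover have "T = R \<circ> \<Gamma> \<circ> R"
  proof
    fix u
    have "inner (R (\<Gamma> (R u))) y = inner (T u) y" for y
    proof -
      have "inner (R (\<Gamma> (R u))) y = inner (R u) (W y)"
        by (simp add: Rsym \<Gamma>(2))
      also have "\<dots> = inner (T y) u"
        using W(2)[of y u] by (simp add: inner_commute)
      also have "\<dots> = inner (T u) y"
        using Tsym[of u y] by (simp add: inner_commute)
      finally show ?thesis .
    qed
    then have "T u = R (\<Gamma> (R u))"
      by (metis vector_eq_rdot)
    then show "T u = (R \<circ> \<Gamma> \<circ> R) u"
      by simp
  qed
  ultimately show ?thesis
    using that by blast
qed

section \<open>Block matrices and positive definite functions\<close>

text \<open>The discriminant argument of the Cauchy-Schwarz inequality, for a quadratic in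
  \<open>t\<close> that is never negative.\<close>

lemma le_mult_of_quadratic_bound:
  fixes a b c :: real
  assumes ab: "a \<ge> 0" "b \<ge> 0" and bound: "\<And>t. 2 * t * c \<le> a\<^sup>2 + t\<^sup>2 * b\<^sup>2"
  shows "\<bar>c\<bar> \<le> a * b"
proof (cases "b = 0")
  case True
  have "c = 0"
  proof (rule ccontr)
    assume "c \<noteq> 0"
    \<comment> \<open>This \<open>t\<close> would give
      \<open>a\<^sup>2 + 1 \<le> a\<^sup>2\<close>.\<close>
    then show False
      using bound[of "(a\<^sup>2 + 1) / (2 * c)"] True by simp
  qed
  with ab show ?thesis by simp
next
  case False
  \<comment> \<open>\<open>c / b\<^sup>2\<close> maximises
    \<open>2 * t * c - t\<^sup>2 * b\<^sup>2\<close>.\<close>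
  have "2 * (c / b\<^sup>2) * c - (c / b\<^sup>2)\<^sup>2 * b\<^sup>2 = c\<^sup>2 / b\<^sup>2"
    using False by (simp add: field_simps power2_eq_square)
  with bound[of "c / b\<^sup>2"] have "c\<^sup>2 / b\<^sup>2 \<le> a\<^sup>2"
    by linarith
  then have "c\<^sup>2 \<le> (a * b)\<^sup>2"
    using False by (simp add: field_simps)
  then show ?thesis
    using ab by (metis abs_le_square_iff abs_of_nonneg mult_nonneg_nonneg)
qed

lemma op_le_iff_inner:
  assumes "bounded_clinear A" "selfadjoint A" "bounded_clinear B" "selfadjoint B"
  shows "op_le A B \<longleftrightarrow> (\<forall>x. inner (A x) x \<le> inner (B x) x)"
proof -
  have "bounded_clinear (\<lambda>x. B x - A x)"
    by (rule bounded_clinear_diff_fun[OF assms(3,1)])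
  moreover have "selfadjoint (\<lambda>x. B x - A x)"
    using assms calculation
    by (simp add: bounded_clinear_def selfadjoint_iff_inner inner_diff_left inner_diff_right)
  ultimately show ?thesis
    by (simp add: op_le_def positive_op_iff inner_diff_left)
qed

lemma bounded_clinear_block_op:
  assumes "bounded_clinear A" "bounded_clinear B" "bounded_clinear C" "bounded_clinear D"
  shows "bounded_clinear (block_op A B C D)"
proof -
  have lin: "bounded_linear A" "bounded_linear B" "bounded_linear C" "bounded_linear D"
    using assms by (auto simp: bounded_clinear_def)
  have "bounded_linear (block_op A B C D)"
    unfolding block_op_def case_prod_beta
    by (intro bounded_linear_Pair bounded_linear_add lin[THEN bounded_linear_compose]
        bounded_linear_fst bounded_linear_snd)
  with assms show ?thesis
    by (auto simp: bounded_clinear_def block_op_def scaleC_prod_def scaleC_add_right)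
qed

text \<open>The block operator is selfadjoint, so its real form decides positivity; the two cross
  terms agree by symmetry of \<open>B\<close>.\<close>

lemma positive_op_block_iff:
  assumes A: "bounded_clinear A" "selfadjoint A" and B: "bounded_clinear B" "selfadjoint B"
  shows "positive_op (block_op A B B A) \<longleftrightarrow>
    (\<forall>x y. 0 \<le> inner (A x) x + 2 * inner (B x) y + inner (A y) y)"
proof -
  have sym: "inner (A x) y = inner x (A y)" "inner (B x) y = inner x (B y)" for x y
    using assms selfadjoint_iff_inner[of A] selfadjoint_iff_inner[of B]
    by (auto simp: bounded_clinear_def)
  have bc: "bounded_clinear (block_op A B B A)"
    by (intro bounded_clinear_block_op A B)
  moreover have "block_op A B B A (c *\<^sub>C p) = c *\<^sub>C block_op A B B A p" for c p
    using bc unfolding bounded_clinear_def by blast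
  then have "selfadjoint (block_op A B B A)"
    by (auto simp: selfadjoint_iff_inner block_op_def sym inner_add_left inner_add_right)
  moreover have "inner (block_op A B B A (x, y)) (x, y)
      = inner (A x) x + 2 * inner (B x) y + inner (A y) y" for x y
    using sym(2)[of x y] by (simp add: block_op_def inner_add_left inner_add_right inner_commute)
  ultimately show ?thesis
    by (auto simp: positive_op_iff)
qed

lemma UNIV_bit: "(UNIV :: bit set) = {0, 1}"
  using bit_not_one_iff by auto

text \<open>A function on the two-element group is a pair \<open>(h 0, h 1)\<close> and has finite
  support. The sums extend from the support to the whole group because
  \<open>T s 0 = 0\<close>.\<close>

lemma positive_definite_bit_iff:
  fixes T :: "bit \<Rightarrow> 'a::complex_inner \<Rightarrow> 'a"
  assumes bounded: "\<And>s. bounded_clinear (T s)"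
    and sa: "selfadjoint (T 0)" "selfadjoint (T 1)"
  shows "positive_definite T \<longleftrightarrow> positive_op (block_op (T 0) (T 1) (T 1) (T 0))"
proof -
  have T0: "T s 0 = 0" for s
    using bounded by (simp add: bounded_clinear_def linear_0 bounded_linear.linear)
  have sum: "(\<Sum>s | h s \<noteq> 0. \<Sum>t | h t \<noteq> 0. cinner (T (- t + s) (h s)) (h t))
      = cinner (block_op (T 0) (T 1) (T 1) (T 0) (h 0, h 1)) (h 0, h 1)" (is "?l = ?r")
    for h :: "bit \<Rightarrow> 'a"
  proof -
    have "?l = (\<Sum>s\<in>UNIV. \<Sum>t\<in>UNIV. cinner (T (- t + s) (h s)) (h t))"
      by (intro sum.mono_neutral_cong_left) (auto simp: UNIV_bit T0 intro!: sum.mono_neutral_cong_left)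
    also have "\<dots> = ?r"
      by (simp add: UNIV_bit block_op_def cinner_prod_def cinner_add_left)
    finally show ?thesis .
  qed
  \<comment> \<open>Each element of the group is its own inverse, so this is
    selfadjointness.\<close>
  have adj: "is_adjoint (T s) (T (- s))" for s
    using sa by (cases s) (auto simp: selfadjoint_def)
  have fin: "finite {s. h s \<noteq> 0}" for h :: "bit \<Rightarrow> 'a"
    by (rule finite_subset[OF subset_UNIV]) (simp add: UNIV_bit)
  have "positive_definite T \<longleftrightarrow>
      (\<forall>h :: bit \<Rightarrow> 'a. cinner (block_op (T 0) (T 1) (T 1) (T 0) (h 0, h 1)) (h 0, h 1) \<in> \<real>\<^sub>\<ge>\<^sub>0)"
    by (simp only: positive_definite_def sum adj fin simp_thms)
  also have "\<dots> \<longleftrightarrow> (\<forall>p. cinner (block_op (T 0) (T 1) (T 1) (T 0) p) p \<in> \<real>\<^sub>\<ge>\<^sub>0)" (is "?a = ?b")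
  proof
    assume ?a
    show ?b
    proof
      fix p
      show "cinner (block_op (T 0) (T 1) (T 1) (T 0) p) p \<in> \<real>\<^sub>\<ge>\<^sub>0"
        using \<open>?a\<close>[rule_format, of "\<lambda>s. if s = 0 then fst p else snd p"] by simp
    qed
  qed auto
  also have "\<dots> \<longleftrightarrow> positive_op (block_op (T 0) (T 1) (T 1) (T 0))"
    by (simp add: positive_op_def bounded_clinear_block_op bounded)
  finally show ?thesis .
qed

theorem proposition3p10:
  fixes T :: "bit \<Rightarrow> 'h::chilbert_space \<Rightarrow> 'h"
  assumes bounded: "\<And>s. bounded_clinear (T s)"
    and selfadjoint_0: "selfadjoint (T 0)"
    and selfadjoint_1: "selfadjoint (T 1)"
  shows "(positive_definite T \<longleftrightarrow> positive_op (block_op (T 0) (T 1) (T 1) (T 0)))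
    \<and> (positive_definite T \<longleftrightarrow>
        positive_op (T 0) \<and>
        (\<exists>\<Gamma>. contraction_on (closure (range (T 0))) \<Gamma> \<and>
          T 1 = op_sqrt (T 0) \<circ> \<Gamma> \<circ> op_sqrt (T 0)))
    \<and> (positive_definite T \<longleftrightarrow>
        positive_op (T 0) \<and> op_le (T 1) (T 0) \<and> op_le (\<lambda>x. - T 1 x) (T 0))"
proof -
  let ?A = "T 0" and ?B = "T 1"
  define dom where "dom \<longleftrightarrow> (\<forall>x. \<bar>inner (?B x) x\<bar> \<le> inner (?A x) x)"
  interpret A: bounded_linear ?A using bounded by (simp add: bounded_clinear_def)
  interpret B: bounded_linear ?B using bounded by (simp add: bounded_clinear_def)
  have Asym: "inner (?A x) y = inner x (?A y)" and Bsym: "inner (?B x) y = inner x (?B y)" for x y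
    using bounded selfadjoint_0 selfadjoint_1
    by (auto simp: bounded_clinear_def selfadjoint_iff_inner)
  \<comment> \<open>Negation is written as a difference to fit
    \<open>bounded_clinear_diff_fun\<close>.\<close>
  have "bounded_clinear (\<lambda>x. 0 - ?B x)"
    by (intro bounded_clinear_diff_fun bounded)
      (simp add: bounded_clinear_def linear_0[OF bounded_linear.linear[OF bounded_linear_scaleC]])
  then have nB: "bounded_clinear (\<lambda>x. - ?B x)" by simp
  moreover have "selfadjoint (\<lambda>x. - ?B x)"
    using nB by (simp add: bounded_clinear_def selfadjoint_iff_inner Bsym)
  ultimately have le: "op_le ?B ?A \<and> op_le (\<lambda>x. - ?B x) ?A \<longleftrightarrow> dom"
    using bounded selfadjoint_0 selfadjoint_1
    by (auto simp: dom_def op_le_iff_inner abs_le_iff)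
  have pos: "positive_op ?A" if dom
  proof -
    have "0 \<le> inner (?A x) x" for x
      by (rule order_trans[OF abs_ge_zero that[unfolded dom_def, rule_format]])
    then show ?thesis
      by (simp add: positive_op_iff bounded selfadjoint_0)
  qed
  \<comment> \<open>The change of variables to \<open>x + y\<close> and \<open>x - y\<close>
    diagonalises the block form; the factor 2 avoids halving the vectors.\<close>
  have polar: "2 * (inner (?A x) x + 2 * inner (?B x) y + inner (?A y) y)
      = (inner (?A (x + y)) (x + y) + inner (?B (x + y)) (x + y))
        + (inner (?A (x - y)) (x - y) - inner (?B (x - y)) (x - y))" for x y
    using Asym[of x y] Bsym[of x y]
    by (simp add: A.add A.diff B.add B.diff inner_add_left inner_add_right inner_diff_left
        inner_diff_right inner_commute)
  have two: "positive_op (block_op ?A ?B ?B ?A) \<longleftrightarrow> dom"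
    unfolding positive_op_block_iff[OF bounded selfadjoint_0 bounded selfadjoint_1]
  proof
    assume *: "\<forall>x y. 0 \<le> inner (?A x) x + 2 * inner (?B x) y + inner (?A y) y"
    show dom
      unfolding dom_def
    proof
      fix x
      show "\<bar>inner (?B x) x\<bar> \<le> inner (?A x) x"
        \<comment> \<open>The choices \<open>y = x\<close> and \<open>y = - x\<close> give the two
          signs.\<close>
        using *[rule_format, of x x] *[rule_format, of x "- x"] by (simp add: A.neg abs_le_iff)
    qed
  next
    assume dom
    then have le: "\<bar>inner (?B z) z\<bar> \<le> inner (?A z) z" for z
      by (simp add: dom_def)
    have nonneg: "0 \<le> inner (?A z) z + inner (?B z) z" "0 \<le> inner (?A z) z - inner (?B z) z" for z
      using le[of z] by linarith+
    show "\<forall>x y. 0 \<le> inner (?A x) x + 2 * inner (?B x) y + inner (?A y) y"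
    proof (intro allI)
      fix x y
      have "0 \<le> 2 * (inner (?A x) x + 2 * inner (?B x) y + inner (?A y) y)"
        unfolding polar by (intro add_nonneg_nonneg nonneg)
      then show "0 \<le> inner (?A x) x + 2 * inner (?B x) y + inner (?A y) y"
        by simp
    qed
  qed
  \<comment> \<open>Stated under positivity of \<open>T 0\<close>, where
    \<open>op_sqrt (T 0)\<close> is known to be a root.\<close>
  have three: "(\<exists>\<Gamma>. contraction_on (closure (range ?A)) \<Gamma> \<and> ?B = op_sqrt ?A \<circ> \<Gamma> \<circ> op_sqrt ?A)
      \<longleftrightarrow> dom" if A: "positive_op ?A"
  proof -
    define R where "R = op_sqrt ?A"
    have R: "positive_op R" "R \<circ> R = ?A"
      unfolding R_def by (rule op_sqrt[OF A])+
    have Rsym: "inner (R x) y = inner x (R y)" for x y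
      using R(1) selfadjoint_iff_inner[of R] by (auto simp: positive_op_iff bounded_clinear_def)
    have AR: "inner (?A x) x = (norm (R x))\<^sup>2" for x
      using fun_cong[OF R(2), of x] Rsym[of "R x" x] by (simp add: power2_norm_eq_inner)
    have cl: "closure (range ?A) = closure (range R)"
      using closure_range_square[OF R(1)] R(2) by simp
    show ?thesis
      unfolding R_def[symmetric] cl
    proof
      assume "\<exists>\<Gamma>. contraction_on (closure (range R)) \<Gamma> \<and> ?B = R \<circ> \<Gamma> \<circ> R"
      then obtain \<Gamma> where \<Gamma>: "contraction_on (closure (range R)) \<Gamma>" and B: "?B = R \<circ> \<Gamma> \<circ> R"
        by auto
      show dom
        unfolding dom_def
      proof
        fix x
        have "R x \<in> closure (range R)"
          using closure_subset[of "range R"] by auto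
        then have "norm (\<Gamma> (R x)) \<le> norm (R x)"
          by (rule contraction_on_norm_le[OF \<Gamma>])
        then have "norm (\<Gamma> (R x)) * norm (R x) \<le> (norm (R x))\<^sup>2"
          by (simp add: power2_eq_square mult_right_mono)
        with Cauchy_Schwarz_ineq2 have "\<bar>inner (\<Gamma> (R x)) (R x)\<bar> \<le> (norm (R x))\<^sup>2"
          by (rule order_trans)
        moreover have "inner (?B x) x = inner (\<Gamma> (R x)) (R x)"
          unfolding B by (simp only: comp_apply Rsym)
        ultimately show "\<bar>inner (?B x) x\<bar> \<le> inner (?A x) x"
          by (simp only: AR)
      qed
    next
      assume dom
      \<comment> \<open>The block form at \<open>(x, - t *\<^sub>R y)\<close> is \<open>(norm (R
        x))\<^sup>2 - 2 * t * inner (?B x) y + t\<^sup>2 * (norm (R y))\<^sup>2\<close>, nonnegative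
        for every \<open>t\<close>.\<close>
      have "\<bar>inner (?B x) y\<bar> \<le> norm (R x) * norm (R y)" for x y
      proof (rule le_mult_of_quadratic_bound)
        fix t
        have "0 \<le> inner (?A x) x + 2 * inner (?B x) (- t *\<^sub>R y) + inner (?A (- t *\<^sub>R y)) (- t *\<^sub>R y)"
          using iffD2[OF two \<open>dom\<close>]
          unfolding positive_op_block_iff[OF bounded selfadjoint_0 bounded selfadjoint_1] by blast
        then show "2 * t * inner (?B x) y \<le> (norm (R x))\<^sup>2 + t\<^sup>2 * (norm (R y))\<^sup>2"
          by (simp add: A.scaleR A.neg AR[symmetric] power2_eq_square[of t] algebra_simps)
      qed auto
      then obtain \<Gamma> where "contraction_on (closure (range R)) \<Gamma>" "?B = R \<circ> \<Gamma> \<circ> R"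
        by (rule contraction_factorization[OF R(1) bounded selfadjoint_1])
      then show "\<exists>\<Gamma>. contraction_on (closure (range R)) \<Gamma> \<and> ?B = R \<circ> \<Gamma> \<circ> R"
        by blast
    qed
  qed
  have "positive_definite T \<longleftrightarrow> dom"
    using positive_definite_bit_iff[OF assms] two by simp
  then show ?thesis
    using two three le pos by blast
qed

end
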